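(* For each positive integer $m$ let $\alpha_m = (2m, 2m-2, \ldots, 2)$, and let $\alpha_0$ be the empty partition. Suppose that either $n$ and $s$ are positive integers, or $s = k/2$ for some odd positive integer $k$ and $n$ is an odd positive integer. Then \[c^{s*\alpha_n}_{s*\alpha_{n-1},\, s*(n+1, n-1)} = \binom{n}{sn+s}_{2s} - \binom{n}{sn+s+1}_{2s},\] where $c^{\lambda}_{\mu,\nu}$ denotes the Littlewood-Richardson coefficient, $s*\lambda$ denotes the partition obtained by multiplying every part of $\lambda$ by $s$, and $\binom{n}{k}_{2s}$ denotes the $2s$-binomial coefficient.
   Context: $r$-binomial coefficients: for positive integers $n, r$ and an integer $k$ with $0\le k\le rn$, $\binom{n}{k}_r$ is the coefficient of $x^k$ in $(1+x+x^2+\cdots+x^r)^n$; for $k > rn$ one sets $\binom{n}{k}_r = 0$. Here $r = 2s$ is a positive integer. Stretching: for a partition $\lambda = (\lambda_1,\lambda_2,\ldots)$, $s*\lambda = (s\lambda_1, s\lambda_2, \ldots)$. Here $s$ may be a half-integer; under the hypotheses all the resulting parts are integers. Littlewood-Richardson coefficients: $c^{\lambda}_{\mu,\nu}$ is the multiplicity of $V^\lambda$ in $V^\mu\otimes V^\nu$, where $V^\mu, V^\nu, V^\lambda$ are irreducible polynomial representations of $GL(N)$ ($N$ at least the number of parts of each partition involved). Equivalently (Littlewood-Richardson rule), $c^{\lambda}_{\mu,\nu}$ is the number of semistandard fillings (weakly increasing along rows, strictly increasing down columns) of the skew shape $\lambda/\mu$ with content $\nu$ (exactly $\nu_i$ entries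 equal to $i$ for each $i$) such that the word obtained by reading the rows from top to bottom, each row from right to left, is a ballot word: in every initial segment, the number of $a$'s is at least the number of $b$'s whenever $a<b$. *)

theory Defs
  imports Complex_Main "HOL-Library.FuncSet" "HOL-Computational_Algebra.Polynomial"
begin

definition rbinom :: "nat \<Rightarrow> nat \<Rightarrow> nat \<Rightarrow> nat" where
  "rbinom r n k = coeff ((\<Sum>i\<le>r. monom 1 i) ^ n) k"

text \<open>The convention that the coefficient is zero for \<open>k > r n\<close> is automatic.\<close>

lemma rbinom_eq_0:
  assumes "r * n < k"
  shows "rbinom r n k = 0"
proof -
  let ?p = "\<Sum>i\<le>r. monom (1::nat) i"
  have "degree ?p \<le> r"
    by (rule degree_sum_le) (auto intro: order_trans[OF degree_monom_le])
  then have "degree (?p ^ n) \<le> r * n"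
    by (meson degree_power_le mult_le_mono1 order_trans)
  then show ?thesis
    using assms by (simp add: rbinom_def coeff_eq_0)
qed

text \<open>
  A partition is a weakly decreasing list of natural numbers; trailing zeros are allowed and
  are immaterial, since all parts beyond the end of the list are read as zero.
  Indices start at 0, so \<open>part p i\<close> is the part with index \<open>i + 1\<close> in the usual notation.
\<close>

definition part :: "nat list \<Rightarrow> nat \<Rightarrow> nat" where
  "part p i = (if i < length p then p ! i else 0)"

text \<open>
  The factor may be a half-integer. When all products are integers, rounding does nothing.
\<close>

definition stretch :: "rat \<Rightarrow> nat list \<Rightarrow> nat list" where
  "stretch s p = map (\<lambda>a. nat \<lfloor>s * of_nat a\<rfloor>) p"

definition alpha :: "nat \<Rightarrow> nat list" where
  "alpha m = map (\<lambda>i. 2 * i) (rev [1..<Suc m])"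

definition skew_cells :: "nat list \<Rightarrow> nat list \<Rightarrow> (nat \<times> nat) set" where
  "skew_cells l m = {(i, j). part m i \<le> j \<and> j < part l i}"

text \<open>Entries are positive integers; the fillings are \<open>undefined\<close> outside the shape, so that
  equal fillings are equal as functions.\<close>

definition semistandard :: "nat list \<Rightarrow> nat list \<Rightarrow> (nat \<times> nat \<Rightarrow> nat) \<Rightarrow> bool" where
  "semistandard l m T \<longleftrightarrow>
     T \<in> skew_cells l m \<rightarrow>\<^sub>E {1..} \<and>
     (\<forall>i j j'. (i, j) \<in> skew_cells l m \<and> (i, j') \<in> skew_cells l m \<and> j < j'
        \<longrightarrow> T (i, j) \<le> T (i, j')) \<and>
     (\<forall>i i' j. (i, j) \<in> skew_cells l m \<and> (i', j) \<in> skew_cells l m \<and> i < i'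
        \<longrightarrow> T (i, j) < T (i', j))"

definition has_content :: "nat list \<Rightarrow> nat list \<Rightarrow> (nat \<times> nat \<Rightarrow> nat) \<Rightarrow> nat list \<Rightarrow> bool" where
  "has_content l m T v \<longleftrightarrow> (\<forall>i. card {c \<in> skew_cells l m. T c = Suc i} = part v i)"

definition reading_word :: "nat list \<Rightarrow> nat list \<Rightarrow> (nat \<times> nat \<Rightarrow> nat) \<Rightarrow> nat list" where
  "reading_word l m T =
     concat (map (\<lambda>i. rev (map (\<lambda>j. T (i, j)) [part m i..<part l i])) [0..<length l])"

text \<open>Letters are positive; the letter 0 never occurs and must not be compared.\<close>

definition ballot :: "nat list \<Rightarrow> bool" where
  "ballot w \<longleftrightarrow>
     (\<forall>k a b. 0 < a \<and> a < b \<longrightarrow> count_list (take k w) b \<le> count_list (take k w) a)"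

definition lr_fillings :: "nat list \<Rightarrow> nat list \<Rightarrow> nat list \<Rightarrow> (nat \<times> nat \<Rightarrow> nat) set" where
  "lr_fillings l m v =
     {T. semistandard l m T \<and> has_content l m T v \<and> ballot (reading_word l m T)}"

text \<open>
  The Littlewood--Richardson coefficient with upper index \<open>l\<close> and lower indices \<open>m\<close>, \<open>v\<close>,
  given by the Littlewood--Richardson rule. It vanishes when the diagram of \<open>m\<close> is not
  contained in that of \<open>l\<close>, in which case there is no skew shape.
\<close>

definition lr_coeff :: "nat list \<Rightarrow> nat list \<Rightarrow> nat list \<Rightarrow> nat" where
  "lr_coeff l m v = (if \<forall>i. part m i \<le> part l i then card (lr_fillings l m v) else 0)"

end

theory Submission
  imports Defs
begin

text \<open>
  Put \<open>r = 2 s\<close>. The skew shape consists of \<open>n\<close> rows of length \<open>r\<close> no two of which meet a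
  common column, so a filling with letters 1 and 2 is determined by the list of the numbers of 1s
  in its rows. Removing the last row gives a recursion for the number of ballot fillings with a
  prescribed number \<open>K\<close> of 1s. The difference of the coefficients at \<open>K\<close> and \<open>K + 1\<close> satisfies the
  same recursion: the sum telescopes, and when it is cut short by the ballot condition the
  boundary term is matched by the symmetry \<open>k \<mapsto> r n - k\<close> of the coefficients. This is the
  Clebsch--Gordan rule for the multiplicities in tensor powers of \<open>V\<^sub>r\<close>.
\<close>

section \<open>The coefficients as a function on all integers: recursion and symmetry\<close>

text \<open>Extension by zero to negative indices, so that recursion, symmetry and telescoping hold
  for every integer index without truncated subtraction.\<close>

definition rbinom_int :: "nat \<Rightarrow> nat \<Rightarrow> int \<Rightarrow> int" where
  "rbinom_int r n k = (if k < 0 then 0 else int (rbinom r n (nat k)))"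

lemma rbinom_int_0: "rbinom_int r 0 k = (if k = 0 then 1 else 0)"
  by (simp add: rbinom_int_def rbinom_def)

lemma rbinom_Suc:
  "rbinom r (Suc n) k = (\<Sum>i\<le>r. if i \<le> k then rbinom r n (k - i) else 0)"
  by (auto simp: rbinom_def sum_distrib_right coeff_sum coeff_monom_mult intro!: sum.cong)

lemma rbinom_int_Suc:
  "rbinom_int r (Suc n) k = (\<Sum>i\<le>r. rbinom_int r n (k - int i))"
proof (cases "k < 0")
  case True
  then show ?thesis by (simp add: rbinom_int_def)
next
  case False
  then show ?thesis
    by (auto simp: rbinom_int_def rbinom_Suc nat_diff_distrib intro!: sum.cong)
qed

text \<open>The generating polynomial is a power of a palindromic one. In the recursion this becomes
  the reversal \<open>i\<close> to \<open>r - i\<close> of the summation index.\<close>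

lemma rbinom_int_sym: "rbinom_int r n (int (r * n) - k) = rbinom_int r n k"
proof (induction n arbitrary: k)
  case 0
  then show ?case by (simp add: rbinom_int_0)
next
  case (Suc n)
  have "rbinom_int r (Suc n) (int (r * Suc n) - k)
      = (\<Sum>i\<le>r. rbinom_int r n (int (r * n) - (k - int (r - i))))"
    by (auto simp: rbinom_int_Suc of_nat_diff algebra_simps intro!: sum.cong)
  also have "\<dots> = (\<Sum>i\<le>r. rbinom_int r n (k - int (r - i)))"
    by (simp only: Suc.IH)
  also have "\<dots> = (\<Sum>i\<le>r. rbinom_int r n (k - int i))"
    using sum.nat_diff_reindex[of "\<lambda>i. rbinom_int r n (k - int i)" "Suc r"]
    by (simp add: lessThan_Suc_atMost)
  finally show ?case by (simp add: rbinom_int_Suc)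
qed

lemma sum_telescope_int:
  fixes g :: "int \<Rightarrow> int"
  shows "(\<Sum>i\<le>m. g (k - int i) - g (k + 1 - int i)) = g (k - int m) - g (k + 1)"
  by (induction m) (simp_all add: algebra_simps)

section \<open>Ballot words in the letters 1 and 2\<close>

text \<open>A letter \<open>b > 2\<close> does not occur, so its inequality is trivial, and
  \<open>b = 2\<close> forces \<open>a = 1\<close> because \<open>a\<close> is positive.\<close>

lemma ballot_iff_two_letters:
  assumes "set w \<subseteq> {1, 2}"
  shows "ballot w \<longleftrightarrow> (\<forall>k. count_list (take k w) 2 \<le> count_list (take k w) 1)"
proof
  assume "ballot w"
  then show "\<forall>k. count_list (take k w) 2 \<le> count_list (take k w) 1"
    by (simp add: ballot_def)
next
  assume *: "\<forall>k. count_list (take k w) 2 \<le> count_list (take k w) 1"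
  show "ballot w" unfolding ballot_def
  proof (intro allI impI)
    fix k a b :: nat
    assume ab: "0 < a \<and> a < b"
    show "count_list (take k w) b \<le> count_list (take k w) a"
    proof (cases "b = 2")
      case True
      with ab have "a = 1" by simp
      with True * show ?thesis by simp
    next
      case False
      with ab assms have "b \<notin> set (take k w)"
        by (auto dest!: in_set_takeD)
      then show ?thesis by (simp add: count_notin)
    qed
  qed
qed

lemma count_list_replicate: "count_list (replicate n x) y = (if x = y then n else 0)"
  by (induction n) auto

text \<open>The appended row has its 2s before its 1s, so within it the excess of 1s over 2s is
  smallest right after the last 2. One inequality at that point controls the whole row.\<close>

lemma ballot_append_row:
  assumes "set w \<subseteq> {1, 2}"
  shows "ballot (w @ replicate a 2 @ replicate b 1) \<longleftrightarrow>
         ballot w \<and> count_list w 2 + a \<le> count_list w 1"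
proof -
  let ?v = "w @ replicate a 2 @ replicate b (1::nat)"
  let ?P = "\<lambda>k. count_list (take k ?v) 2 \<le> count_list (take k ?v) 1"
  have v: "set ?v \<subseteq> {1, 2}" using assms by auto
  have "(\<forall>k. ?P k) \<longleftrightarrow>
        (\<forall>k. count_list (take k w) 2 \<le> count_list (take k w) 1) \<and>
        count_list w 2 + a \<le> count_list w 1"
  proof (intro iffI conjI allI)
    fix k assume *: "\<forall>k. ?P k"
    show "count_list (take k w) 2 \<le> count_list (take k w) 1"
      using *[rule_format, of "min k (length w)"] by (simp add: min_def split: if_splits)
    \<comment> \<open>The prefix of length \<open>length w + a\<close> ends exactly after the last
      appended 2.\<close>
    show "count_list w 2 + a \<le> count_list w 1"
      using *[rule_format, of "length w + a"] by (simp add: count_list_replicate)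
  next
    fix k
    assume *: "(\<forall>k. count_list (take k w) 2 \<le> count_list (take k w) 1) \<and>
        count_list w 2 + a \<le> count_list w 1"
    show "?P k"
    proof (cases "k \<le> length w")
      case True
      then show ?thesis using * by simp
    next
      case False
      then have "count_list (take k ?v) 2 = count_list w 2 + min (k - length w) a"
        and "count_list w 1 \<le> count_list (take k ?v) 1"
        by (auto simp: count_list_replicate)
      then show ?thesis using * by linarith
    qed
  qed
  then show ?thesis
    using ballot_iff_two_letters[OF assms] ballot_iff_two_letters[OF v] by simp
qed

section \<open>Counting lists of row contents with ballot word\<close>

text \<open>Each \<open>b\<close> is the number of 1s in a row of length \<open>r\<close>; rows are
  read from right to left, hence the 2s come first.\<close>

definition row_word :: "nat \<Rightarrow> nat list \<Rightarrow> nat list" where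
  "row_word r bs = concat (map (\<lambda>b. replicate (r - b) 2 @ replicate b 1) bs)"

text \<open>\<open>K\<close> is an integer so that \<open>K - int b\<close> in the recursion is
  exact; for negative \<open>K\<close> the set is empty.\<close>

definition ballot_rows :: "nat \<Rightarrow> nat \<Rightarrow> int \<Rightarrow> nat list set" where
  "ballot_rows r n K =
     {bs. length bs = n \<and> set bs \<subseteq> {..r} \<and> int (sum_list bs) = K \<and> ballot (row_word r bs)}"

lemma set_row_word: "set (row_word r bs) \<subseteq> {1, 2}"
  by (auto simp: row_word_def)

lemma count_row_word_1: "count_list (row_word r bs) 1 = sum_list bs"
  by (induction bs) (auto simp: row_word_def count_list_replicate)

lemma count_row_word_2:
  "set bs \<subseteq> {..r} \<Longrightarrow> count_list (row_word r bs) 2 + sum_list bs = r * length bs"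
  by (induction bs) (auto simp: row_word_def count_list_replicate)

lemma finite_ballot_rows: "finite (ballot_rows r n K)"
  by (rule finite_subset[OF _ finite_lists_length_eq[of "{..r}" n]])
     (auto simp: ballot_rows_def)

text \<open>The first \<open>n\<close> rows hold \<open>K - b\<close> letters 1 and
  \<open>r * n - (K - b)\<close> letters 2. The ballot inequality after the \<open>r - b\<close> new
  2s, namely \<open>r * n - (K - b) + (r - b) <= K - b\<close>, is the stated bound on
  \<open>b\<close>.\<close>

lemma snoc_in_ballot_rows_iff:
  "bs @ [b] \<in> ballot_rows r (Suc n) K \<longleftrightarrow>
     b \<le> r \<and> int b \<le> 2 * K - int (r * Suc n) \<and> bs \<in> ballot_rows r n (K - int b)"
proof -
  have "ballot (row_word r (bs @ [b])) \<longleftrightarrow>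
      ballot (row_word r bs) \<and> count_list (row_word r bs) 2 + (r - b) \<le> sum_list bs"
    using ballot_append_row[OF set_row_word, of r bs "r - b" b]
    unfolding count_row_word_1 by (simp add: row_word_def)
  moreover have "count_list (row_word r bs) 2 + (r - b) \<le> sum_list bs \<longleftrightarrow>
      int b \<le> 2 * K - int (r * Suc n)"
    if "set bs \<subseteq> {..r}" "length bs = n" "int (sum_list bs) = K - int b" "b \<le> r"
  proof -
    have "int (count_list (row_word r bs) 2) + int (sum_list bs) = int (r * n)"
      using count_row_word_2[OF that(1)] that(2) by (metis of_nat_add)
    moreover have "int (r * Suc n) = int (r * n) + int r" by simp
    ultimately show ?thesis using that(3,4) by linarith
  qed
  ultimately show ?thesis by (auto simp: ballot_rows_def)
qed

lemma card_ballot_rows_Suc: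
  "card (ballot_rows r (Suc n) K) =
     (\<Sum>b | b \<le> r \<and> int b \<le> 2 * K - int (r * Suc n). card (ballot_rows r n (K - int b)))"
proof -
  let ?B = "{b. b \<le> r \<and> int b \<le> 2 * K - int (r * Suc n)}"
  have "ballot_rows r (Suc n) K = (\<lambda>(b, bs). bs @ [b]) ` (SIGMA b:?B. ballot_rows r n (K - int b))"
  proof (intro set_eqI iffI)
    fix cs assume cs: "cs \<in> ballot_rows r (Suc n) K"
    then have "cs \<noteq> []" by (auto simp: ballot_rows_def)
    then obtain bs b where bs: "cs = bs @ [b]" by (metis rev_exhaust)
    with cs show "cs \<in> (\<lambda>(b, bs). bs @ [b]) ` (SIGMA b:?B. ballot_rows r n (K - int b))"
      by (auto simp only: snoc_in_ballot_rows_iff intro!: image_eqI[of _ _ "(b, bs)"])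
  qed (auto simp only: snoc_in_ballot_rows_iff)
  moreover have "inj_on (\<lambda>(b, bs). bs @ [b]) (SIGMA b:?B. ballot_rows r n (K - int b))"
    by (auto simp: inj_on_def)
  ultimately show ?thesis
    by (simp add: card_image finite_ballot_rows)
qed

text \<open>The hypothesis says that at least half of the letters are 1s. Below that range no ballot
  word exists, while the difference of coefficients can be negative.\<close>

lemma card_ballot_rows:
  assumes "int (r * n) \<le> 2 * K"
  shows "int (card (ballot_rows r n K)) = rbinom_int r n K - rbinom_int r n (K + 1)"
  using assms
proof (induction n arbitrary: K)
  case 0
  then have "ballot_rows r 0 K = (if K = 0 then {[]} else {})"
    by (auto simp: ballot_rows_def row_word_def ballot_def)
  \<comment> \<open>The hypothesis excludes \<open>K = -1\<close>, where the right-hand side would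
    be -1.\<close>
  with 0 show ?case by (auto simp: rbinom_int_0)
next
  case (Suc n)
  \<comment> \<open>\<open>h\<close> is the ballot bound on the last row, nonnegative by the
    hypothesis, so \<open>nat\<close> loses nothing; \<open>m\<close> is the largest admissible
    number of 1s there.\<close>
  define h where "h = nat (2 * K - int (r * Suc n))"
  define m where "m = min r h"
  have h: "int h = 2 * K - int (r * n) - int r"
    using Suc.prems by (simp add: h_def)
  have B: "{b. b \<le> r \<and> int b \<le> 2 * K - int (r * Suc n)} = {..m}"
    using h by (auto simp: m_def)
  have "int (card (ballot_rows r (Suc n) K)) = (\<Sum>b\<le>m. int (card (ballot_rows r n (K - int b))))"
    unfolding card_ballot_rows_Suc B by simp
  also have "\<dots> = (\<Sum>b\<le>m. rbinom_int r n (K - int b) - rbinom_int r n (K + 1 - int b))"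
  proof (intro sum.cong refl)
    fix b assume "b \<in> {..m}"
    then have "int b \<le> int r" "int b \<le> int h" by (auto simp: m_def)
    \<comment> \<open>Both brackets are nonnegative for \<open>b <= m\<close>, which keeps the
      induction hypothesis applicable.\<close>
    moreover have "2 * (K - int b) = int (r * n) + (int r - int b) + (int h - int b)"
      by (simp only: h) simp
    ultimately have "int (r * n) \<le> 2 * (K - int b)" by linarith
    from Suc.IH[OF this]
    show "int (card (ballot_rows r n (K - int b))) =
        rbinom_int r n (K - int b) - rbinom_int r n (K + 1 - int b)"
      by (simp add: algebra_simps)
  qed
  also have "\<dots> = rbinom_int r n (K - int m) - rbinom_int r n (K + 1)"
    by (rule sum_telescope_int)
  also have "rbinom_int r n (K - int m) = rbinom_int r n (K - int r)"
  proof (cases "r \<le> h")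
    case True
    then show ?thesis by (simp add: m_def)
  next
    case False
    \<comment> \<open>Here \<open>m = h\<close>, and \<open>K - h\<close> is the mirror image of
      \<open>K - r\<close> under the symmetry.\<close>
    then have "K - int m = int (r * n) - (K - int r)"
      using h by (simp add: m_def)
    then show ?thesis by (simp only: rbinom_int_sym)
  qed
  \<comment> \<open>The telescoping is now run backwards over the full range \<open>b <= r\<close>,
    where the recursion for the coefficients applies.\<close>
  also have "rbinom_int r n (K - int r) - rbinom_int r n (K + 1) =
      (\<Sum>b\<le>r. rbinom_int r n (K - int b) - rbinom_int r n (K + 1 - int b))"
    by (rule sum_telescope_int[symmetric])
  also have "\<dots> = rbinom_int r (Suc n) K - rbinom_int r (Suc n) (K + 1)"
    by (simp add: rbinom_int_Suc sum_subtractf)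
  finally show ?case .
qed

section \<open>Fillings of the skew shape and their row contents\<close>

text \<open>The inverse of recording the number of 1s per row. The value \<open>undefined\<close>
  outside the shape matches the extensional functions in \<open>semistandard\<close>.\<close>

definition fill_rows :: "nat \<Rightarrow> nat \<Rightarrow> nat list \<Rightarrow> nat \<times> nat \<Rightarrow> nat" where
  "fill_rows r n bs = (\<lambda>(i, j).
     if i < n \<and> r * (n - 1 - i) \<le> j \<and> j < r * (n - i)
     then if j < r * (n - 1 - i) + bs ! i then 1 else 2 else undefined)"

text \<open>Induction on the row length: a last entry 1 forces all entries to be 1, and a last entry
  2 leaves the threshold \<open>b\<close> unchanged.\<close>

lemma monotone_row_eq_initial_segment:
  fixes f :: "nat \<Rightarrow> nat"
  assumes range: "\<And>j. m \<le> j \<Longrightarrow> j < m + r \<Longrightarrow> f j \<in> {1, 2}"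
    and mono: "\<And>j j'. m \<le> j \<Longrightarrow> j < j' \<Longrightarrow> j' < m + r \<Longrightarrow> f j \<le> f j'"
  shows "\<exists>b\<le>r. \<forall>j. m \<le> j \<and> j < m + r \<longrightarrow> f j = (if j < m + b then 1 else 2)"
  using assms
proof (induction r)
  case 0
  then show ?case by auto
next
  case (Suc r)
  then obtain b where b: "b \<le> r"
    "\<And>j. m \<le> j \<Longrightarrow> j < m + r \<Longrightarrow> f j = (if j < m + b then 1 else 2)"
    by (metis add_Suc_right less_Suc_eq)
  show ?case
  proof (cases "f (m + r) = 1")
    case True
    then have "f j = 1" if "m \<le> j" "j < m + Suc r" for j
      using Suc.prems(1)[of j] Suc.prems(2)[of j "m + r"] that
      by (cases "j = m + r") auto
    then show ?thesis by (intro exI[of _ "Suc r"]) auto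
  next
    case False
    then have "f (m + r) = 2" using Suc.prems(1)[of "m + r"] by auto
    then show ?thesis using b by (intro exI[of _ b]) (auto simp: less_Suc_eq)
  qed
qed

lemma rev_map_upt_two_valued:
  assumes "b \<le> r" "\<And>j. m \<le> j \<Longrightarrow> j < m + r \<Longrightarrow> f j = (if j < m + b then 1 else 2)"
  shows "rev (map f [m..<m + r]) = replicate (r - b) 2 @ replicate b (1::nat)"
proof -
  have "[m..<m + r] = [m..<m + b] @ [m + b..<m + r]"
    using upt_add_eq_append[of m "m + b" "r - b"] assms(1) by simp
  moreover have "map f [m..<m + b] = replicate b 1"
    using assms by (intro replicate_eqI) auto
  moreover have "map f [m + b..<m + r] = replicate (r - b) 2"
    using assms by (intro replicate_eqI) auto
  ultimately show ?thesis by simp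
qed

text \<open>Only part sizes enter here, which confines rational stretching and rounding to the
  instantiation. The length of \<open>l\<close> is fixed because \<open>reading_word\<close> runs
  over the indices of that list.\<close>

locale staircase_rows =
  fixes r n K :: nat and l m v :: "nat list"
  assumes length_l: "length l = n"
    and part_l: "\<And>i. part l i = r * (n - i)"
    and part_m: "\<And>i. part m i = r * (n - 1 - i)"
    and part_v: "\<And>i. part v i = (if i = 0 then K else if i = 1 then r * n - K else 0)"
begin

lemma part_l_eq: "i < n \<Longrightarrow> part l i = part m i + r"
  by (cases "n - i") (auto simp: part_l part_m)

lemma cells: "skew_cells l m = (SIGMA i:{..<n}. {part m i..<part m i + r})"
proof -
  have "part m i \<le> j \<and> j < part l i \<longleftrightarrow> i < n \<and> part m i \<le> j \<and> j < part m i + r" for i j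
  proof (cases "i < n")
    case True
    then show ?thesis using part_l_eq by simp
  qed (simp add: part_l)
  then show ?thesis by (auto simp: skew_cells_def)
qed

lemma finite_cells: "finite (skew_cells l m)"
  by (simp add: cells)

text \<open>A lower row ends no later than the column where a higher one starts. Hence strictness
  down columns is vacuous.\<close>

lemma columns_disjoint:
  assumes "(i, j) \<in> skew_cells l m" "(i', j) \<in> skew_cells l m"
  shows "i' \<le> i"
proof (rule ccontr)
  assume "\<not> i' \<le> i"
  then have "n - i' \<le> n - 1 - i" by simp
  then have "part l i' \<le> part m i" by (simp add: part_l part_m)
  with assms show False by (auto simp: skew_cells_def)
qed

lemma fill_rows_eq:
  "fill_rows r n bs (i, j) =
     (if (i, j) \<in> skew_cells l m then if j < part m i + bs ! i then 1 else 2 else undefined)"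
  by (auto simp: fill_rows_def skew_cells_def part_m part_l)

lemma reading_word_fill_rows:
  assumes "length bs = n" "set bs \<subseteq> {..r}"
  shows "reading_word l m (fill_rows r n bs) = row_word r bs"
proof -
  have row: "rev (map (\<lambda>j. fill_rows r n bs (i, j)) [part m i..<part l i]) =
      replicate (r - bs ! i) 2 @ replicate (bs ! i) 1" if "i < n" for i
    unfolding part_l_eq[OF that]
  proof (rule rev_map_upt_two_valued)
    show "bs ! i \<le> r" using assms that nth_mem by fastforce
  qed (auto simp: fill_rows_eq cells that)
  have "reading_word l m (fill_rows r n bs) =
      concat (map (\<lambda>i. replicate (r - bs ! i) 2 @ replicate (bs ! i) 1) [0..<n])"
    unfolding reading_word_def length_l
    by (intro arg_cong[of _ _ concat] map_cong refl row) simp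
  also have "\<dots> = row_word r (map (\<lambda>i. bs ! i) [0..<n])"
    by (simp add: row_word_def comp_def)
  also have "map (\<lambda>i. bs ! i) [0..<n] = bs"
    using assms(1) by (metis map_nth)
  finally show ?thesis .
qed

lemma semistandard_fill_rows: "semistandard l m (fill_rows r n bs)"
proof -
  have "fill_rows r n bs \<in> skew_cells l m \<rightarrow>\<^sub>E {1..}"
    by (auto simp: fill_rows_eq PiE_def extensional_def Pi_def)
  moreover have "\<not> i < i'" if "(i, j) \<in> skew_cells l m" "(i', j) \<in> skew_cells l m" for i i' j
    using columns_disjoint[OF that] by simp
  ultimately show ?thesis
    unfolding semistandard_def by (auto simp: fill_rows_eq)
qed

lemma card_entries_fill_rows:
  assumes "length bs = n" "set bs \<subseteq> {..r}"
  shows "card {c \<in> skew_cells l m. fill_rows r n bs c = Suc i} =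
     (if i = 0 then sum_list bs else if i = 1 then r * n - sum_list bs else 0)"
proof -
  have le: "bs ! i \<le> r" if "i < n" for i
    using assms that nth_mem by fastforce
  have sum: "(\<Sum>i<n. bs ! i) = sum_list bs"
    using assms(1) by (simp add: sum_list_sum_nth atLeast0LessThan)
  have *: "{c \<in> skew_cells l m. fill_rows r n bs c = 1} =
      (SIGMA i:{..<n}. {part m i..<part m i + bs ! i})"
    using le by (fastforce simp: fill_rows_eq cells split: if_splits)
  have 1: "card {c \<in> skew_cells l m. fill_rows r n bs c = 1} = sum_list bs"
    unfolding * by (simp add: sum)
  \<comment> \<open>The 2s are counted as the complement of the 1s among the \<open>r * n\<close>
    cells.\<close>
  have **: "{c \<in> skew_cells l m. fill_rows r n bs c = 2} =
      skew_cells l m - {c \<in> skew_cells l m. fill_rows r n bs c = 1}"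
    by (auto simp: fill_rows_eq)
  have 2: "card {c \<in> skew_cells l m. fill_rows r n bs c = 2} = r * n - sum_list bs"
  proof -
    have "card (skew_cells l m) = r * n" by (simp add: cells mult.commute)
    then show ?thesis
      unfolding ** using finite_cells by (subst card_Diff_subset) (auto simp: 1[simplified])
  qed
  have none: "{c \<in> skew_cells l m. fill_rows r n bs c = Suc i} = {}" if "i > 1"
    using that by (auto simp: fill_rows_eq)
  consider "i = 0" | "i = 1" | "i > 1" by linarith
  then show ?thesis
  proof cases
    case 3
    from none[OF 3] 3 show ?thesis by (simp only: card.empty) simp
  qed (use 1 2 in \<open>simp_all add: numeral_2_eq_2\<close>)
qed

lemma inj_on_fill_rows: "inj_on (fill_rows r n) (ballot_rows r n (int K))"
proof (rule inj_onI)
  fix bs cs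
  assume bs: "bs \<in> ballot_rows r n (int K)" and cs: "cs \<in> ballot_rows r n (int K)"
    and eq: "fill_rows r n bs = fill_rows r n cs"
  have row: "x ! i \<le> y ! i"
    if "fill_rows r n x = fill_rows r n y" "i < n" "x ! i \<le> r" for x y i
  proof (rule ccontr)
    assume "\<not> x ! i \<le> y ! i"
    \<comment> \<open>At this cell the first filling has 1 and the second has 2;
      \<open>x ! i <= r\<close> places the cell inside the shape.\<close>
    moreover have "fill_rows r n x (i, part m i + y ! i) = fill_rows r n y (i, part m i + y ! i)"
      by (simp add: that(1))
    ultimately show False using that(2,3) by (simp add: fill_rows_eq cells)
  qed
  have "bs ! i = cs ! i" if "i < n" for i
  proof -
    have "bs ! i \<in> set bs" "cs ! i \<in> set cs"
      using bs cs that by (simp_all add: ballot_rows_def)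
    then have "bs ! i \<le> r" "cs ! i \<le> r"
      using bs cs by (auto simp: ballot_rows_def)
    then show ?thesis using row[OF eq that] row[OF eq[symmetric] that] by simp
  qed
  then show "bs = cs"
    using bs cs by (auto simp: ballot_rows_def intro!: nth_equalityI)
qed

text \<open>The content has at most two nonzero parts, so all entries are 1 or 2, and each weakly
  increasing row is then fixed by its number of 1s.\<close>

lemma fill_rows_surj:
  assumes T: "T \<in> lr_fillings l m v"
  shows "\<exists>bs. length bs = n \<and> set bs \<subseteq> {..r} \<and> T = fill_rows r n bs"
proof -
  from T have ss: "semistandard l m T" and ct: "has_content l m T v"
    by (auto simp: lr_fillings_def)
  have entry: "T c \<in> {1, 2}" if c: "c \<in> skew_cells l m" for c
  proof (rule ccontr)
    assume ne: "T c \<notin> {1, 2}"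
    have "T \<in> skew_cells l m \<rightarrow>\<^sub>E {1..}" using ss by (simp add: semistandard_def)
    from PiE_mem[OF this c] have "T c \<ge> 1" by simp
    with ne obtain i where i: "T c = Suc i" "i > 1"
      by (cases "T c") auto
    then have "card {c \<in> skew_cells l m. T c = Suc i} = 0"
      using ct by (simp add: has_content_def part_v)
    \<comment> \<open>Finiteness matters, since \<open>card\<close> is also 0 on infinite
      sets.\<close>
    then have "{c \<in> skew_cells l m. T c = Suc i} = {}"
      using finite_cells by (subst (asm) card_0_eq) auto
    then show False using i(1) c by blast
  qed
  have "\<exists>b\<le>r. \<forall>j. part m i \<le> j \<and> j < part m i + r \<longrightarrow>
      T (i, j) = (if j < part m i + b then 1 else 2)" if "i < n" for i
  proof (rule monotone_row_eq_initial_segment)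
    show "T (i, j) \<in> {1, 2}" if "part m i \<le> j" "j < part m i + r" for j
      using entry[of "(i, j)"] that \<open>i < n\<close> by (simp add: cells)
    show "T (i, j) \<le> T (i, j')" if "part m i \<le> j" "j < j'" "j' < part m i + r" for j j'
    proof -
      have "(i, j) \<in> skew_cells l m" "(i, j') \<in> skew_cells l m"
        using that \<open>i < n\<close> by (auto simp: cells)
      then show ?thesis using ss that(2) unfolding semistandard_def by blast
    qed
  qed
  then obtain b where b: "\<And>i. i < n \<Longrightarrow> b i \<le> r"
    "\<And>i j. i < n \<Longrightarrow> part m i \<le> j \<Longrightarrow> j < part m i + r \<Longrightarrow>
       T (i, j) = (if j < part m i + b i then 1 else 2)"
    by metis
  have "T (i, j) = fill_rows r n (map b [0..<n]) (i, j)" for i j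
  proof (cases "(i, j) \<in> skew_cells l m")
    case True
    then show ?thesis using b(2)[of i j] by (simp add: fill_rows_eq) (auto simp: cells)
  next
    case False
    then have "T (i, j) = undefined"
      using ss by (auto simp: semistandard_def PiE_def extensional_def)
    with False show ?thesis by (simp add: fill_rows_eq)
  qed
  then have "T = fill_rows r n (map b [0..<n])" by auto
  then show ?thesis
    using b(1) by (intro exI[of _ "map b [0..<n]"]) auto
qed

lemma fill_rows_in_lr_fillings_iff:
  assumes "length bs = n" "set bs \<subseteq> {..r}"
  shows "fill_rows r n bs \<in> lr_fillings l m v \<longleftrightarrow> bs \<in> ballot_rows r n (int K)"
proof -
  \<comment> \<open>Once the number of 1s is \<open>K\<close>, the number of 2s is automatically
    \<open>r * n - K\<close>.\<close>
  have "has_content l m (fill_rows r n bs) v \<longleftrightarrow> sum_list bs = K"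
    unfolding has_content_def card_entries_fill_rows[OF assms] part_v
    by (auto split: if_splits)
  then show ?thesis
    using assms
    by (auto simp: lr_fillings_def ballot_rows_def semistandard_fill_rows reading_word_fill_rows)
qed

lemma lr_coeff_eq_card_ballot_rows: "lr_coeff l m v = card (ballot_rows r n (int K))"
proof -
  have "lr_fillings l m v = fill_rows r n ` ballot_rows r n (int K)"
  proof (intro equalityI subsetI)
    fix T assume "T \<in> lr_fillings l m v"
    with fill_rows_surj[OF this] fill_rows_in_lr_fillings_iff
    show "T \<in> fill_rows r n ` ballot_rows r n (int K)" by blast
  next
    fix T assume "T \<in> fill_rows r n ` ballot_rows r n (int K)"
    then obtain bs where "T = fill_rows r n bs" "bs \<in> ballot_rows r n (int K)" by blast
    moreover from this have "length bs = n" "set bs \<subseteq> {..r}" by (auto simp: ballot_rows_def)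
    ultimately show "T \<in> lr_fillings l m v" by (simp add: fill_rows_in_lr_fillings_iff)
  qed
  moreover have "\<forall>i. part m i \<le> part l i"
    by (simp add: part_l part_m diff_le_mono2)
  ultimately show ?thesis
    by (simp add: lr_coeff_def card_image inj_on_fill_rows)
qed

end

section \<open>Specialization to the stretched partitions\<close>

lemma part_alpha: "part (alpha m) i = 2 * (m - i)"
  by (auto simp: part_def alpha_def rev_nth simp del: upt_Suc)

lemma part_stretch: "part (stretch s p) i = nat \<lfloor>s * of_nat (part p i)\<rfloor>"
  by (simp add: part_def stretch_def)

theorem theorem3:
  fixes n :: nat and s :: rat
  assumes "(0 < n \<and> (\<exists>k::nat. 0 < k \<and> s = of_nat k)) \<or>
           ((\<exists>k::nat. odd k \<and> s = of_nat k / 2) \<and> odd n)"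
  shows "int (lr_coeff (stretch s (alpha n)) (stretch s (alpha (n - 1))) (stretch s [n + 1, n - 1])) =
         int (rbinom (nat \<lfloor>2 * s\<rfloor>) n (nat \<lfloor>s * of_nat n + s\<rfloor>)) -
         int (rbinom (nat \<lfloor>2 * s\<rfloor>) n (nat \<lfloor>s * of_nat n + s + 1\<rfloor>))"
proof -
  \<comment> \<open>For integral \<open>s\<close>, \<open>r\<close> is even; in the half-integral
    case \<open>n + 1\<close> is even. Either way \<open>s * (n + 1)\<close> is an integer, later
    called \<open>K\<close>.\<close>
  obtain r where r: "2 * s = of_nat r" and even: "even (r * (n + 1))" and n: "n > 0"
  proof -
    from assms consider k where "0 < n" "s = of_nat k" | k where "s = of_nat k / 2" "odd n"
      by blast
    then show ?thesis
    proof cases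
      case (1 k)
      then show ?thesis using that[of "2 * k"] by simp
    next
      case (2 k)
      then show ?thesis using that[of k] by (simp add: odd_pos)
    qed
  qed
  from even obtain K where K: "r * (n + 1) = 2 * K" by (elim evenE)
  have s: "s = of_nat r / 2" using r by simp
  \<comment> \<open>All parts of \<open>alpha\<close> are even, so their stretched values are
    natural numbers and the floor is exact.\<close>
  have sx: "s * of_nat (2 * x) = of_nat (r * x)" for x
    by (simp add: s)
  have K_rat: "of_nat r * (1 + of_nat n) = 2 * (of_nat K :: rat)"
    using arg_cong[OF K, of "of_nat :: nat \<Rightarrow> rat"] by (simp add: distrib_left)
  have "2 * (s * of_nat (n + 1)) = 2 * of_nat K"
    using K_rat by (simp add: s)
  then have sK: "s * of_nat (n + 1) = of_nat K" by simp
  \<comment> \<open>This makes the natural subtraction \<open>r * n - K\<close> exact; its value is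
    the second stretched part \<open>s * (n - 1)\<close>.\<close>
  have "K \<le> r * n"
  proof -
    have "r \<le> r * n" using n by simp
    moreover have "r * (n + 1) = r * n + r" by simp
    ultimately show ?thesis using K by linarith
  qed
  then have "of_nat (r * n - K) = of_nat r * of_nat n - (of_nat K :: rat)"
    by (simp add: of_nat_diff)
  then have sK': "s * of_nat (n - 1) = of_nat (r * n - K)"
    using K_rat n by (simp add: s of_nat_diff field_simps)
  interpret staircase_rows r n K "stretch s (alpha n)" "stretch s (alpha (n - 1))"
    "stretch s [n + 1, n - 1]"
  proof
    show "length (stretch s (alpha n)) = n" by (simp add: stretch_def alpha_def)
    show "part (stretch s (alpha n)) i = r * (n - i)" for i
      unfolding part_stretch part_alpha sx by (simp only: floor_of_nat nat_int)
    show "part (stretch s (alpha (n - 1))) i = r * (n - 1 - i)" for i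
      unfolding part_stretch part_alpha sx by (simp only: floor_of_nat nat_int)
    show "part (stretch s [n + 1, n - 1]) i = (if i = 0 then K else if i = 1 then r * n - K else 0)" for i
    proof -
      have "nat \<lfloor>s * of_nat (n + 1)\<rfloor> = K" "nat \<lfloor>s * of_nat (n - 1)\<rfloor> = r * n - K"
        unfolding sK sK' by (simp_all only: floor_of_nat nat_int)
      moreover have "part [n + 1, n - 1] i = (if i = 0 then n + 1 else if i = 1 then n - 1 else 0)"
        by (auto simp: part_def less_Suc_eq)
      ultimately show ?thesis
        unfolding part_stretch by (simp only: split: if_split) simp
    qed
  qed
  have arg: "s * of_nat n + s = of_nat K"
    using sK by (simp add: algebra_simps)
  have "int (lr_coeff (stretch s (alpha n)) (stretch s (alpha (n - 1))) (stretch s [n + 1, n - 1])) =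
      rbinom_int r n (int K) - rbinom_int r n (int K + 1)"
    unfolding lr_coeff_eq_card_ballot_rows
  proof (rule card_ballot_rows)
    have "r * n \<le> 2 * K" using K by simp
    then show "int (r * n) \<le> 2 * int K" by linarith
  qed
  also have "\<dots> = int (rbinom r n K) - int (rbinom r n (K + 1))"
    by (simp add: rbinom_int_def nat_add_distrib)
  finally show ?thesis
    unfolding arg r by (simp add: nat_add_distrib)
qed

end
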